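(* Let $M$ be a matroid of rank $r$, with rank function also denoted $r(\cdot)$ and closure operator $\mathrm{cl}$. Then $M$ is a fundamental transversal matroid if and only if there is an injection $\phi:\mathcal{Z}(M)\to 2^{[r]}$ with (1) $|\phi(F)|=r(F)$ for all $F\in\mathcal{Z}(M)$, (2) $\phi\bigl(\mathrm{cl}(F\cup G)\bigr)=\phi(F)\cup\phi(G)$ for all $F,G\in\mathcal{Z}(M)$, and (3) $r\bigl(\bigcap_{F\in\mathcal{F}}F\bigr)=\bigl|\bigcap_{F\in\mathcal{F}}\phi(F)\bigr|$ for every subset $\mathcal{F}$ of $\mathcal{Z}(M)$. Moreover, in (3), "every subset" may equivalently be replaced by "every filter", or by "every antichain".
   Context: Matroids have finite ground sets; $E(M)$ is the ground set of $M$. A set $X\subseteq E(M)$ is cyclic if it is a union of circuits of $M$ (the empty set is cyclic). $\mathcal{Z}(M)$ is the set of all cyclic flats of $M$, ordered by inclusion; it is a lattice in which the join of $F,G$ is $\mathrm{cl}(F\cup G)$. An antichain in $\mathcal{Z}(M)$ is a subset $\mathcal{F}\subseteq\mathcal{Z}(M)$ no two of whose members are related by inclusion. A filter in $\mathcal{Z}(M)$ is a subset $\mathcal{F}\subseteq\mathcal{Z}(M)$ such that if $A\in\mathcal{F}$, $B\in\mathcal{Z}(M)$ and $A\subseteq B$, then $B\in\mathcal{F}$. $[r]=\{1,\ldots,r\}$ and $2^{[r]}$ is the set of all subsets of $[r]$. For the empty family $\mathcal{F}$, the intersection of members of $\mathcal{F}$ is $E(M)$ and the intersection of the sets $\phi(F)$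 is $[r]$. A set system on a set $S$ is a finite multiset $(A_1,\ldots,A_s)$ of subsets of $S$. A partial transversal of it is a subset $I\subseteq S$ for which there is an injection $\psi:I\to\{1,\ldots,s\}$ with $x\in A_{\psi(x)}$ for all $x\in I$. The partial transversals are the independent sets of a matroid on $S$; such a matroid is called transversal and the set system is a presentation of it. A fundamental transversal matroid is a transversal matroid that has a presentation $(A_1,\ldots,A_s)$ for which no difference $A_i-\bigcup_{j\ne i}A_j$, for $1\le i\le s$, is empty. (Equivalently, $M$ is a matroid having a fundamental basis, that is, a basis $B$ such that each $F\in\mathcal{Z}(M)$ is spanned by $B\cap F$.) *)

theory Defs
  imports Main
begin

locale matroid =
  fixes E :: "'a set" and indep :: "'a set \<Rightarrow> bool"
  assumes finite_ground: "finite E"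
    and indep_subset_ground: "indep I \<Longrightarrow> I \<subseteq> E"
    and indep_empty: "indep {}"
    and indep_mono: "indep J \<Longrightarrow> I \<subseteq> J \<Longrightarrow> indep I"
    and indep_augment:
      "indep I \<Longrightarrow> indep J \<Longrightarrow> card I < card J \<Longrightarrow> \<exists>x\<in>J - I. indep (insert x I)"

(* A finite multiset of subsets of S is represented by a list; the order of the entries is irrelevant. *)
definition set_system :: "'a set \<Rightarrow> 'a set list \<Rightarrow> bool" where
  "set_system S As \<longleftrightarrow> (\<forall>i<length As. As ! i \<subseteq> S)"

definition partial_transversal :: "'a set \<Rightarrow> 'a set list \<Rightarrow> 'a set \<Rightarrow> bool" where
  "partial_transversal S As I \<longleftrightarrow>
     I \<subseteq> S \<and> (\<exists>\<psi>. inj_on \<psi> I \<and> (\<forall>x\<in>I. \<psi> x < length As \<and> x \<in> As ! \<psi> x))"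

context matroid
begin

definition rank :: "'a set \<Rightarrow> nat" where
  "rank X = Max (card ` {I. I \<subseteq> X \<and> indep I})"

definition cl :: "'a set \<Rightarrow> 'a set" where
  "cl X = {x \<in> E. rank (insert x X) = rank X}"

definition circuit :: "'a set \<Rightarrow> bool" where
  "circuit C \<longleftrightarrow> C \<subseteq> E \<and> \<not> indep C \<and> (\<forall>D. D \<subset> C \<longrightarrow> indep D)"

definition flat :: "'a set \<Rightarrow> bool" where
  "flat F \<longleftrightarrow> F \<subseteq> E \<and> cl F = F"

definition cyclic :: "'a set \<Rightarrow> bool" where
  "cyclic X \<longleftrightarrow> (\<exists>\<C>. (\<forall>C\<in>\<C>. circuit C) \<and> X = \<Union>\<C>)"

definition cyclic_flats :: "'a set set" where
  "cyclic_flats = {F. flat F \<and> cyclic F}"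

definition filter_cf :: "'a set set \<Rightarrow> bool" where
  "filter_cf \<F> \<longleftrightarrow> \<F> \<subseteq> cyclic_flats \<and> (\<forall>A\<in>\<F>. \<forall>B\<in>cyclic_flats. A \<subseteq> B \<longrightarrow> B \<in> \<F>)"

definition antichain_cf :: "'a set set \<Rightarrow> bool" where
  "antichain_cf \<F> \<longleftrightarrow> \<F> \<subseteq> cyclic_flats \<and> (\<forall>A\<in>\<F>. \<forall>B\<in>\<F>. A \<subseteq> B \<longrightarrow> A = B)"

definition presentation :: "'a set list \<Rightarrow> bool" where
  "presentation As \<longleftrightarrow> set_system E As \<and> (\<forall>I. indep I \<longleftrightarrow> partial_transversal E As I)"

definition fundamental_transversal :: bool where
  "fundamental_transversal \<longleftrightarrow>
     (\<exists>As. presentation As \<and>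
        (\<forall>i<length As. As ! i - (\<Union>j\<in>{..<length As} - {i}. As ! j) \<noteq> {}))"

(* \<phi> stands for a map from the cyclic flats to the subsets of {1..r};
   its values outside the cyclic flats are irrelevant. *)
definition rank_join_injection :: "('a set \<Rightarrow> nat set) \<Rightarrow> bool" where
  "rank_join_injection \<phi> \<longleftrightarrow>
     inj_on \<phi> cyclic_flats \<and>
     (\<forall>F\<in>cyclic_flats. \<phi> F \<subseteq> {1..rank E}) \<and>
     (\<forall>F\<in>cyclic_flats. card (\<phi> F) = rank F) \<and>
     (\<forall>F\<in>cyclic_flats. \<forall>G\<in>cyclic_flats. \<phi> (cl (F \<union> G)) = \<phi> F \<union> \<phi> G)"

(* Intersecting with E and {1..r} only matters for the empty family,
   whose intersections are E and {1..r} by convention. *)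
definition rank_inter_eq :: "('a set \<Rightarrow> nat set) \<Rightarrow> 'a set set \<Rightarrow> bool" where
  "rank_inter_eq \<phi> \<F> \<longleftrightarrow>
     rank (E \<inter> (\<Inter>F\<in>\<F>. F)) = card ({1..rank E} \<inter> (\<Inter>F\<in>\<F>. \<phi> F))"

end

end

(* In a fundamental presentation (A_1, ..., A_r) with e_i in A_i only, every circuit that meets A_i
   spans e_i. Hence a cyclic flat F meets A_i iff it contains e_i, and \<phi>(F) = {i. e_i \<in> F} works.

   Conversely, (2) gives for each i a largest cyclic flat F_i with i \<notin> \<phi>(F_i). Let X_i be the
   intersection of the cyclic flats not contained in F_i. Condition (3) shows that X_i - F_i has at
   least as many elements as there are indices j with F_j = F_i, and X_i - F_i, X_j - F_j are disjoint
   when F_i \<noteq> F_j, so distinct e_i \<in> X_i - F_i can be chosen. Then e_i \<in> F iff i \<in> \<phi>(F), so that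
   B = {e_1, ..., e_r} meets each cyclic flat F in r(F) elements. This makes B independent and hence a
   fundamental basis, and the cocircuits E - cl(B - e_i) form the required presentation. *)

theory Submission
  imports Defs
begin

context matroid
begin

section \<open>Independent sets and rank\<close>

lemma indep_finite: "indep I \<Longrightarrow> finite I"
  by (rule finite_subset[OF indep_subset_ground finite_ground])

lemma finite_indep_subsets: "finite {I. I \<subseteq> X \<and> indep I}"
  by (rule finite_subset[of _ "Pow E"]) (use indep_subset_ground finite_ground in auto)

lemma card_le_rank: "indep I \<Longrightarrow> I \<subseteq> X \<Longrightarrow> card I \<le> rank X"
  unfolding rank_def using finite_indep_subsets by (intro Max_ge) auto

lemma ex_indep_card_rank: "\<exists>I\<subseteq>X. indep I \<and> card I = rank X"
proof -
  have "rank X \<in> card ` {I. I \<subseteq> X \<and> indep I}"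
    unfolding rank_def using finite_indep_subsets indep_empty by (intro Max_in) auto
  then show ?thesis by auto
qed

lemma indep_extend:
  assumes "indep I" "I \<subseteq> X"
  obtains J where "I \<subseteq> J" "J \<subseteq> X" "indep J" "card J = rank X"
proof -
  have "\<exists>J. I \<subseteq> J \<and> J \<subseteq> X \<and> indep J \<and> card J = rank X"
    using assms
  proof (induction "rank X - card I" arbitrary: I rule: less_induct)
    case less
    show ?case
    proof (cases "card I = rank X")
      case True
      then show ?thesis using less.prems by blast
    next
      case False
      then have lt: "card I < rank X" using card_le_rank[OF less.prems] by simp
      obtain K where K: "K \<subseteq> X" "indep K" "card K = rank X" using ex_indep_card_rank by blast
      obtain x where x: "x \<in> K - I" "indep (insert x I)"
        using indep_augment[OF less.prems(1) K(2)] K(3) lt by auto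
      have "card (insert x I) = Suc (card I)" using x indep_finite[OF less.prems(1)] by simp
      then have "rank X - card (insert x I) < rank X - card I" using lt by simp
      moreover have "insert x I \<subseteq> X" using x(1) K(1) less.prems(2) by blast
      ultimately obtain J where "insert x I \<subseteq> J \<and> J \<subseteq> X \<and> indep J \<and> card J = rank X"
        using less.hyps[OF _ x(2)] by blast
      then show ?thesis by (intro exI[of _ J]) blast
    qed
  qed
  then show ?thesis using that by blast
qed

lemma rank_mono:
  assumes "X \<subseteq> Y"
  shows "rank X \<le> rank Y"
proof -
  obtain I where "I \<subseteq> X" "indep I" "card I = rank X" using ex_indep_card_rank by blast
  then show ?thesis using card_le_rank[of I Y] assms by simp
qed

lemma rank_indep:
  assumes "indep I"
  shows "rank I = card I"
proof (rule antisym)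
  obtain J where "J \<subseteq> I" "indep J" "card J = rank I" using ex_indep_card_rank by blast
  then show "rank I \<le> card I" using card_mono[OF indep_finite[OF assms], of J] by simp
  show "card I \<le> rank I" using card_le_rank[OF assms] by simp
qed

section \<open>Closure\<close>

text \<open>A largest independent subset of \<open>insert x X\<close> can be grown from the basis
  \<open>I\<close> of \<open>X\<close>, so the rank increases exactly when \<open>x\<close> extends
  \<open>I\<close>. The closure axioms below rest on this test.\<close>

lemma cl_iff_indep_card_rank:
  assumes I: "indep I" "I \<subseteq> X" "card I = rank X" and x: "x \<in> E"
  shows "x \<in> cl X \<longleftrightarrow> x \<in> I \<or> \<not> indep (insert x I)"
proof
  assume "x \<in> cl X"
  then have r: "rank (insert x X) = rank X" by (simp add: cl_def)
  show "x \<in> I \<or> \<not> indep (insert x I)"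
  proof (rule ccontr)
    assume "\<not> ?thesis"
    then have n: "x \<notin> I" "indep (insert x I)" by auto
    have "card (insert x I) \<le> rank (insert x X)" using card_le_rank[OF n(2)] I(2) by blast
    then show False using r n I indep_finite[OF I(1)] by simp
  qed
next
  assume a: "x \<in> I \<or> \<not> indep (insert x I)"
  obtain J where J: "I \<subseteq> J" "J \<subseteq> insert x X" "indep J" "card J = rank (insert x X)"
    using indep_extend[OF I(1), of "insert x X"] I(2) by blast
  \<comment> \<open>If \<open>x \<in> J\<close>, then \<open>insert x I\<close> is independent, so
    \<open>a\<close> leaves only \<open>x \<in> I\<close>, whence \<open>x \<in> X\<close>.\<close>
  have "J \<subseteq> X"
  proof (cases "x \<in> J")
    case True
    then have "indep (insert x I)" using J(1) by (intro indep_mono[OF J(3)]) blast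
    then show ?thesis using a I J by auto
  qed (use J in auto)
  then have "rank (insert x X) \<le> rank X" using J card_le_rank[OF J(3), of X] by simp
  moreover have "rank X \<le> rank (insert x X)" by (rule rank_mono) auto
  ultimately show "x \<in> cl X" using x by (simp add: cl_def)
qed

lemma cl_indep_iff: "indep I \<Longrightarrow> x \<in> E \<Longrightarrow> x \<in> cl I \<longleftrightarrow> x \<in> I \<or> \<not> indep (insert x I)"
  using cl_iff_indep_card_rank[of I I] rank_indep by simp

lemma cl_ground: "cl X \<subseteq> E"
  by (auto simp: cl_def)

lemma subset_cl: "X \<subseteq> E \<Longrightarrow> X \<subseteq> cl X"
  by (auto simp: cl_def insert_absorb)

lemma cl_eq_cl_indep:
  assumes "indep I" "I \<subseteq> X" "card I = rank X"
  shows "cl X = cl I"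
  using cl_iff_indep_card_rank[OF assms] cl_indep_iff[OF assms(1)] cl_ground by blast

text \<open>An independent subset of \<open>cl X\<close> larger than a basis \<open>I\<close> of
  \<open>X\<close> would augment \<open>I\<close> by an element of \<open>cl X\<close>, against the
  basis test.\<close>

lemma rank_cl: "rank (cl X) = rank X"
proof (rule antisym)
  obtain I where I: "I \<subseteq> X" "indep I" "card I = rank X" using ex_indep_card_rank by blast
  obtain J where J: "J \<subseteq> cl X" "indep J" "card J = rank (cl X)" using ex_indep_card_rank by blast
  show "rank (cl X) \<le> rank X"
  proof (rule ccontr)
    assume "\<not> ?thesis"
    then obtain x where x: "x \<in> J - I" "indep (insert x I)"
      using indep_augment[OF I(2) J(2)] I J by auto
    moreover have "x \<in> cl X" using x J by blast
    ultimately show False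
      using cl_iff_indep_card_rank[OF I(2,1,3)] cl_ground by blast
  qed
  \<comment> \<open>\<open>X\<close> may leave the ground set, so \<open>X \<subseteq> cl X\<close>
    can fail; the independent set \<open>I\<close> does lie in \<open>E\<close>.\<close>
  have "I \<subseteq> cl X"
    using I indep_subset_ground by (auto simp: cl_def insert_absorb)
  then show "rank X \<le> rank (cl X)" using I card_le_rank[OF I(2), of "cl X"] by simp
qed

lemma cl_cl: "cl (cl X) = cl X"
proof -
  obtain I where I: "I \<subseteq> X" "indep I" "card I = rank X" using ex_indep_card_rank by blast
  have "I \<subseteq> cl X"
    using I indep_subset_ground by (auto simp: cl_def insert_absorb)
  then have "cl (cl X) = cl I" using cl_eq_cl_indep[OF I(2)] I(3) rank_cl by simp
  moreover have "cl X = cl I" using cl_eq_cl_indep I by blast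
  ultimately show ?thesis by simp
qed

text \<open>Extend a basis of \<open>X\<close> to one of \<open>Y\<close>: an element dependent on
  the smaller basis is dependent on the larger.\<close>

lemma cl_mono:
  assumes "X \<subseteq> Y"
  shows "cl X \<subseteq> cl Y"
proof
  fix z assume z: "z \<in> cl X"
  then have zE: "z \<in> E" using cl_ground by blast
  obtain I where I: "I \<subseteq> X" "indep I" "card I = rank X" using ex_indep_card_rank by blast
  obtain J where J: "I \<subseteq> J" "J \<subseteq> Y" "indep J" "card J = rank Y"
    using indep_extend[OF I(2), of Y] I(1) assms by blast
  have "z \<in> I \<or> \<not> indep (insert z I)"
    using cl_iff_indep_card_rank[OF I(2,1,3) zE] z by blast
  then have "z \<in> J \<or> \<not> indep (insert z J)"
    using J(1) indep_mono[of "insert z J" "insert z I"] by blast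
  then show "z \<in> cl Y" using cl_iff_indep_card_rank[OF J(3,2,4) zE] by blast
qed

lemma cl_subset_cl: "X \<subseteq> cl Y \<Longrightarrow> cl X \<subseteq> cl Y"
  using cl_mono[of X "cl Y"] cl_cl by simp

lemma indep_not_in_cl_Diff:
  assumes "indep B" "b \<in> B"
  shows "b \<notin> cl (B - {b})"
proof -
  have "indep (B - {b})" using indep_mono[OF assms(1)] by blast
  moreover have "b \<in> E" using indep_subset_ground[OF assms(1)] assms(2) by blast
  moreover have "insert b (B - {b}) = B" using assms(2) by blast
  ultimately show ?thesis using cl_indep_iff[of "B - {b}" b] assms(1) by simp
qed

text \<open>Splits a basis of \<open>X\<close> along \<open>Z\<close>. Later it is read backwards: a
  known difference of two ranks forces elements in \<open>X - Z\<close>.\<close>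

lemma rank_le_rank_Int_plus_card_Diff:
  assumes "finite X"
  shows "rank X \<le> rank (X \<inter> Z) + card (X - Z)"
proof -
  obtain I where I: "I \<subseteq> X" "indep I" "card I = rank X" using ex_indep_card_rank by blast
  have "card I = card (I \<inter> Z) + card (I - Z)"
    using indep_finite[OF I(2)] by (metis card_Int_Diff)
  moreover have "card (I \<inter> Z) \<le> rank (X \<inter> Z)"
    by (rule card_le_rank) (use indep_mono[OF I(2), of "I \<inter> Z"] I(1) in auto)
  moreover have "card (I - Z) \<le> card (X - Z)"
    using I assms by (intro card_mono) auto
  ultimately show ?thesis using I by simp
qed

section \<open>Circuits, cyclic sets and cyclic flats\<close>

lemma dependent_contains_circuit:
  assumes "X \<subseteq> E" "\<not> indep X"
  obtains C where "circuit C" "C \<subseteq> X"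
proof -
  have fin: "finite X" by (rule finite_subset[OF assms(1) finite_ground])
  have "\<exists>C\<subseteq>X. circuit C"
    using fin assms
  proof (induction X rule: finite_psubset_induct)
    case (psubset X)
    show ?case
    proof (cases "\<forall>D. D \<subset> X \<longrightarrow> indep D")
      case True
      then show ?thesis using psubset.prems by (auto simp: circuit_def)
    next
      case False
      then obtain D where D: "D \<subset> X" "\<not> indep D" by blast
      with psubset.IH[OF D(1)] psubset.prems show ?thesis by (meson psubset_imp_subset subset_trans)
    qed
  qed
  then show ?thesis using that by blast
qed

lemma circuit_rank_less:
  assumes "circuit C"
  shows "rank C < card C"
proof -
  obtain I where I: "I \<subseteq> C" "indep I" "card I = rank C" using ex_indep_card_rank by blast
  then have "I \<subset> C" using assms by (auto simp: circuit_def)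
  moreover have "finite C" by (rule finite_subset[OF _ finite_ground]) (use assms in \<open>auto simp: circuit_def\<close>)
  ultimately show ?thesis using I psubset_card_mono[of C I] by simp
qed

lemma cyclic_Un:
  assumes "cyclic X" "cyclic Y"
  shows "cyclic (X \<union> Y)"
proof -
  obtain \<C> \<D> where "\<forall>C\<in>\<C>. circuit C" "X = \<Union>\<C>" "\<forall>C\<in>\<D>. circuit C" "Y = \<Union>\<D>"
    using assms unfolding cyclic_def by blast
  then have "(\<forall>C\<in>\<C> \<union> \<D>. circuit C) \<and> X \<union> Y = \<Union>(\<C> \<union> \<D>)" by blast
  then show ?thesis unfolding cyclic_def by blast
qed

lemma cyclic_empty: "cyclic {}"
  unfolding cyclic_def by (rule exI[of _ "{}"]) auto

lemma cyclic_ground: "cyclic X \<Longrightarrow> X \<subseteq> E"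
  unfolding cyclic_def circuit_def by blast

lemma cyclic_circuit: "circuit C \<Longrightarrow> cyclic C"
  unfolding cyclic_def by (rule exI[of _ "{C}"]) auto

text \<open>An element of \<open>cl X - X\<close> lies on a circuit whose other elements belong to a
  basis of \<open>X\<close>.\<close>

lemma cyclic_cl:
  assumes X: "cyclic X"
  shows "cyclic (cl X)"
proof -
  have XE: "X \<subseteq> E" by (rule cyclic_ground[OF X])
  have "\<exists>C. circuit C \<and> C \<subseteq> cl X \<and> x \<in> C" if x: "x \<in> cl X" for x
  proof (cases "x \<in> X")
    case True
    then show ?thesis using X subset_cl[OF XE] unfolding cyclic_def by blast
  next
    case False
    have xE: "x \<in> E" using x cl_ground by blast
    obtain I where I: "I \<subseteq> X" "indep I" "card I = rank X" using ex_indep_card_rank by blast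
    then have "\<not> indep (insert x I)"
      using cl_iff_indep_card_rank[OF I(2,1,3) xE] x False by blast
    then obtain C where C: "circuit C" "C \<subseteq> insert x I"
      using dependent_contains_circuit[of "insert x I"] xE indep_subset_ground[OF I(2)] by blast
    have "x \<in> C"
    proof (rule ccontr)
      assume "x \<notin> C"
      then have "C \<subseteq> I" using C by blast
      then have "indep C" by (rule indep_mono[OF I(2)])
      then show False using C by (simp add: circuit_def)
    qed
    then show ?thesis using C I x subset_cl[OF XE] by blast
  qed
  then have "cl X = \<Union>{C. circuit C \<and> C \<subseteq> cl X}" by blast
  then show ?thesis
    unfolding cyclic_def by (intro exI[of _ "{C. circuit C \<and> C \<subseteq> cl X}"]) simp
qed

lemma cl_in_cyclic_flats: "cyclic X \<Longrightarrow> cl X \<in> cyclic_flats"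
  using cyclic_cl cl_cl cl_ground by (simp add: cyclic_flats_def flat_def)

lemma cyclic_flatsD:
  assumes "F \<in> cyclic_flats"
  shows "cl F = F" "cyclic F" "F \<subseteq> E"
  using assms by (auto simp: cyclic_flats_def flat_def)

lemma finite_cyclic_flats: "finite cyclic_flats"
  by (rule finite_subset[of _ "Pow E"]) (auto simp: finite_ground dest!: cyclic_flatsD(3))

lemma join_in_cyclic_flats: "F \<in> cyclic_flats \<Longrightarrow> G \<in> cyclic_flats \<Longrightarrow> cl (F \<union> G) \<in> cyclic_flats"
  by (intro cl_in_cyclic_flats cyclic_Un cyclic_flatsD(2))

section \<open>Matching an independent set into a basis\<close>

text \<open>The elements of \<^term>\<open>D\<close> are those of the fundamental circuit of \<^term>\<open>x\<close> with respect to \<^term>\<open>B\<close>.\<close>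
lemma ex_minimal_spanning_subset:
  assumes B: "indep B" and x: "x \<in> cl B"
  obtains D where "D \<subseteq> B" "x \<in> cl D" "\<And>b. b \<in> D \<Longrightarrow> x \<notin> cl (B - {b})"
proof -
  have xE: "x \<in> E" using x cl_ground by blast
  have "finite {D. D \<subseteq> B \<and> x \<in> cl D}" using indep_finite[OF B] by simp
  moreover have "{D. D \<subseteq> B \<and> x \<in> cl D} \<noteq> {}" using x by blast
  ultimately obtain D where D: "D \<in> {D. D \<subseteq> B \<and> x \<in> cl D}"
      and min: "\<And>D'. D' \<in> {D. D \<subseteq> B \<and> x \<in> cl D} \<Longrightarrow> D' \<subseteq> D \<Longrightarrow> D = D'"
    by (metis (no_types, lifting) finite_has_minimal)
  \<comment> \<open>By minimality \<open>x\<close> is not in \<open>cl (D - {b})\<close>, so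
    exchange puts \<open>b\<close> into \<open>cl (insert x (D - {b}))\<close>. If
    \<open>B - {b}\<close> also spanned \<open>x\<close>, it would span \<open>b\<close>, against
    independence of \<open>B\<close>.\<close>
  have "x \<notin> cl (B - {b})" if b: "b \<in> D" for b
  proof
    assume xb: "x \<in> cl (B - {b})"
    have bB: "b \<in> B" using b D by blast
    have bx: "b \<noteq> x" using indep_not_in_cl_Diff[OF B bB] xb by blast
    have x1: "x \<notin> cl (D - {b})" using min[of "D - {b}"] D b by blast
    have indD: "indep D" "indep (D - {b})" by (rule indep_mono[OF B], use D in blast)+
    have DE: "D \<subseteq> E" using indep_subset_ground indD by blast
    have xD: "x \<notin> D" using x1 bx subset_cl[of "D - {b}"] DE by blast
    have ind1: "indep (insert x (D - {b}))" using x1 cl_indep_iff[OF indD(2) xE] by blast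
    have "\<not> indep (insert x D)" using cl_indep_iff[OF indD(1) xE] D xD by blast
    moreover have "insert b (insert x (D - {b})) = insert x D" using b by blast
    ultimately have "b \<in> cl (insert x (D - {b}))"
      using cl_indep_iff[OF ind1, of b] b DE by auto
    moreover have "insert x (D - {b}) \<subseteq> cl (B - {b})"
      using xb subset_cl[of "B - {b}"] D indep_subset_ground[OF B] by blast
    ultimately have "b \<in> cl (B - {b})" using cl_subset_cl by blast
    then show False using indep_not_in_cl_Diff[OF B bB] by blast
  qed
  then show ?thesis using that D by blast
qed

text \<open>Symmetric exchange replaces an element of \<^term>\<open>I - B\<close> by the element of \<^term>\<open>B\<close> that it is
  matched with, so Hall's theorem is not needed.\<close>
lemma indep_matching:
  assumes B: "indep B" and I: "indep I" "I \<subseteq> cl B"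
  shows "\<exists>\<sigma>. inj_on \<sigma> I \<and> \<sigma> ` I \<subseteq> B \<and> (\<forall>x\<in>I. x \<notin> cl (B - {\<sigma> x}))"
  using I
proof (induction "card (I - B)" arbitrary: I rule: less_induct)
  case less
  show ?case
  proof (cases "I \<subseteq> B")
    case True
    then have "inj_on id I \<and> id ` I \<subseteq> B \<and> (\<forall>x\<in>I. x \<notin> cl (B - {id x}))"
      using indep_not_in_cl_Diff[OF B] by auto
    then show ?thesis by blast
  next
    case False
    then obtain x where x: "x \<in> I" "x \<notin> B" by blast
    obtain D where D: "D \<subseteq> B" "x \<in> cl D" "\<And>b. b \<in> D \<Longrightarrow> x \<notin> cl (B - {b})"
      using ex_minimal_spanning_subset[OF B] x less.prems(2) by blast
    \<comment> \<open>Otherwise \<open>I - {x}\<close> would span \<open>x\<close>. An element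
      \<open>b\<close> of \<open>D\<close> outside this closure can replace \<open>x\<close> in
      \<open>I\<close>, and \<open>b \<in> D\<close> makes it an admissible partner for
      \<open>x\<close>.\<close>
    have "\<not> D \<subseteq> cl (I - {x})"
      using D(2) cl_subset_cl indep_not_in_cl_Diff[OF less.prems(1) x(1)] by blast
    then obtain b where b: "b \<in> D" "b \<notin> cl (I - {x})" by blast
    have bB: "b \<in> B" using b D by blast
    have BE: "B \<subseteq> E" using indep_subset_ground[OF B] .
    have indIx: "indep (I - {x})" using indep_mono[OF less.prems(1)] by blast
    have bI: "b \<notin> I - {x}" using b(2) subset_cl indep_subset_ground[OF indIx] by blast
    have ind: "indep (insert b (I - {x}))" using cl_indep_iff[OF indIx] b(2) bB BE by blast
    have sub: "insert b (I - {x}) \<subseteq> cl B" using less.prems(2) subset_cl[OF BE] bB by blast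
    have "insert b (I - {x}) - B = (I - B) - {x}" using x bB by blast
    then have "card (insert b (I - {x}) - B) < card (I - B)"
      using card_Diff1_less[of "I - B" x] indep_finite[OF less.prems(1)] x by simp
    from less.hyps[OF this ind sub] obtain \<sigma> where \<sigma>:
      "inj_on \<sigma> (insert b (I - {x}))" "\<sigma> ` insert b (I - {x}) \<subseteq> B"
      "\<forall>y\<in>insert b (I - {x}). y \<notin> cl (B - {\<sigma> y})" by blast
    \<comment> \<open>An element of \<open>B\<close> can only be matched with itself, since
      \<open>B - {c}\<close> contains \<open>b\<close> for every \<open>c \<noteq> b\<close>. So no
      element of \<open>I - {x}\<close> is matched with \<open>b\<close>, and \<open>b\<close> can
      be handed to \<open>x\<close>.\<close>
    have sb: "\<sigma> b = b"
    proof (rule ccontr)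
      assume "\<sigma> b \<noteq> b"
      then have "b \<in> B - {\<sigma> b}" using bB by simp
      moreover have "B - {\<sigma> b} \<subseteq> cl (B - {\<sigma> b})" by (rule subset_cl) (use BE in blast)
      ultimately have "b \<in> cl (B - {\<sigma> b})" by blast
      then show False using \<sigma>(3) by blast
    qed
    have n: "b \<notin> \<sigma> ` (I - {x})"
    proof
      assume "b \<in> \<sigma> ` (I - {x})"
      then obtain y where y: "y \<in> I - {x}" "\<sigma> y = \<sigma> b" using sb by auto
      then have "y = b" using inj_onD[OF \<sigma>(1) y(2)] by simp
      then show False using y(1) bI by simp
    qed
    let ?\<tau> = "\<sigma>(x := b)"
    have "inj_on ?\<tau> I"
      using \<sigma>(1) n by (auto simp: inj_on_def)
    moreover have "?\<tau> ` I \<subseteq> B" using \<sigma>(2) bB by auto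
    moreover have "\<forall>y\<in>I. y \<notin> cl (B - {?\<tau> y})" using \<sigma>(3) D(3) b(1) by auto
    ultimately show ?thesis by blast
  qed
qed

text \<open>The hypothesis \<open>span\<close> is spanning in numerical form:
  \<open>B \<inter> F\<close> is independent, so with \<open>rank F\<close> elements it is a basis
  of \<open>F\<close>. Matching shows that independent sets are partial transversals; conversely, a
  partial transversal containing a circuit \<open>C\<close> would inject \<open>C\<close> into
  \<open>B \<inter> cl C\<close>, which has only \<open>rank C\<close> elements.\<close>

lemma fundamental_basis_imp_fundamental_transversal:
  assumes B: "indep B" "card B = rank E"
    and span: "\<And>F. F \<in> cyclic_flats \<Longrightarrow> card (B \<inter> F) = rank F"
  shows fundamental_transversal
proof -
  define r where "r = rank E"
  have BE: "B \<subseteq> E" using indep_subset_ground[OF B(1)] .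
  have clB: "cl B = E"
    using cl_eq_cl_indep[OF B(1) BE B(2)] subset_cl[of E] cl_ground by blast
  obtain e where e: "bij_betw e {..<r} B"
    using ex_bij_betw_nat_finite[OF indep_finite[OF B(1)]] B(2)
    unfolding r_def by (metis atLeast0LessThan)
  define As where "As = map (\<lambda>i. E - cl (B - {e i})) [0..<r]"
  have len: "length As = r" by (simp add: As_def)
  have nth: "As ! i = E - cl (B - {e i})" if "i < r" for i using that by (simp add: As_def)
  have eB: "e i \<in> B" if "i < r" for i using bij_betwE[OF e] that by simp
  have "indep I \<longleftrightarrow> partial_transversal E As I" for I
  proof
    assume I: "indep I"
    have IE: "I \<subseteq> E" using indep_subset_ground[OF I] .
    obtain \<sigma> where \<sigma>: "inj_on \<sigma> I" "\<sigma> ` I \<subseteq> B" "\<forall>x\<in>I. x \<notin> cl (B - {\<sigma> x})"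
      using indep_matching[OF B(1) I] IE clB by auto
    define f where "f = the_inv_into {..<r} e"
    have f: "f b < r" "e (f b) = b" if "b \<in> B" for b
      using bij_betwE[OF bij_betw_the_inv_into[OF e]] f_the_inv_into_f_bij_betw[OF e, of b] that
      by (auto simp: f_def)
    have \<sigma>B: "\<sigma> x \<in> B" if "x \<in> I" for x using \<sigma>(2) that by blast
    have "inj_on (f \<circ> \<sigma>) I"
    proof (rule inj_onI)
      fix x y assume xy: "x \<in> I" "y \<in> I" "(f \<circ> \<sigma>) x = (f \<circ> \<sigma>) y"
      then have "\<sigma> x = \<sigma> y" using f(2)[OF \<sigma>B] by (metis comp_apply)
      then show "x = y" using inj_onD[OF \<sigma>(1)] xy by simp
    qed
    moreover have "\<forall>x\<in>I. (f \<circ> \<sigma>) x < length As \<and> x \<in> As ! (f \<circ> \<sigma>) x"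
      using f[OF \<sigma>B] \<sigma>(3) IE nth len by auto
    ultimately show "partial_transversal E As I"
      unfolding partial_transversal_def using IE by blast
  next
    assume "partial_transversal E As I"
    then obtain \<psi> where I: "I \<subseteq> E" "inj_on \<psi> I" "\<forall>x\<in>I. \<psi> x < r \<and> x \<in> As ! \<psi> x"
      unfolding partial_transversal_def len by blast
    show "indep I"
    proof (rule ccontr)
      assume "\<not> indep I"
      then obtain C where C: "circuit C" "C \<subseteq> I" using dependent_contains_circuit I(1) by blast
      have F: "cl C \<in> cyclic_flats" using cl_in_cyclic_flats[OF cyclic_circuit[OF C(1)]] .
      have CE: "C \<subseteq> E" using C I by blast
      have ind: "indep (B \<inter> cl C)" using indep_mono[OF B(1)] by blast
      have spn: "cl C = cl (B \<inter> cl C)"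
        using cl_eq_cl_indep[OF ind _ span[OF F]] cl_cl by blast
      \<comment> \<open>If \<open>cl C\<close> missed this basis element, the rest of
        \<open>B\<close> would span \<open>cl C\<close> and hence \<open>x\<close>, but
        \<open>x\<close> lies in the complement of that span.\<close>
      have "e (\<psi> x) \<in> B \<inter> cl C" if x: "x \<in> C" for x
      proof -
        have p: "\<psi> x < r" "x \<notin> cl (B - {e (\<psi> x)})" using I(3) C x nth by auto
        have "e (\<psi> x) \<in> cl C"
        proof (rule ccontr)
          assume "e (\<psi> x) \<notin> cl C"
          then have "cl (B \<inter> cl C) \<subseteq> cl (B - {e (\<psi> x)})" by (intro cl_mono) blast
          then show False using p(2) spn x subset_cl[OF CE] by blast
        qed
        then show ?thesis using eB p by blast
      qed
      moreover have "inj_on (\<lambda>x. e (\<psi> x)) C"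
        using I(2,3) C(2) bij_betw_imp_inj_on[OF e]
        by (simp add: inj_on_def subset_iff)
      ultimately have "card C \<le> card (B \<inter> cl C)"
        using indep_finite[OF ind] by (intro card_inj_on_le[of "\<lambda>x. e (\<psi> x)"]) auto
      also have "\<dots> = rank C" using span[OF F] rank_cl by simp
      finally show False using circuit_rank_less[OF C(1)] by simp
    qed
  qed
  then have "presentation As"
    unfolding presentation_def set_system_def using nth len by auto
  moreover have "As ! i - (\<Union>j\<in>{..<length As} - {i}. As ! j) \<noteq> {}" if i: "i < length As" for i
  proof -
    have ir: "i < r" using i len by simp
    \<comment> \<open>The element \<open>e i\<close> witnesses the nonempty difference: it is
      spanned by \<open>B - {e j}\<close> exactly when \<open>j \<noteq> i\<close>.\<close>
    have "e i \<in> As ! i"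
      using nth[OF ir] indep_not_in_cl_Diff[OF B(1) eB[OF ir]] eB[OF ir] BE by blast
    moreover have "e i \<notin> As ! j" if j: "j < r" "j \<noteq> i" for j
    proof -
      have "e i \<noteq> e j" using e ir j by (auto simp: bij_betw_def inj_on_def)
      then have "e i \<in> B - {e j}" using eB[OF ir] by simp
      moreover have "B - {e j} \<subseteq> cl (B - {e j})" by (rule subset_cl) (use BE in blast)
      ultimately have "e i \<in> cl (B - {e j})" by blast
      then show ?thesis using nth[OF j(1)] by blast
    qed
    ultimately show ?thesis using len by blast
  qed
  ultimately show ?thesis unfolding fundamental_transversal_def by blast
qed

section \<open>From the injection to a fundamental basis\<close>

lemma rank_join_injectionD:
  assumes "rank_join_injection \<phi>" "F \<in> cyclic_flats"
  shows "\<phi> F \<subseteq> {1..rank E}" "card (\<phi> F) = rank F" "finite (\<phi> F)"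
    and "G \<in> cyclic_flats \<Longrightarrow> \<phi> (cl (F \<union> G)) = \<phi> F \<union> \<phi> G"
  using assms finite_subset[of "\<phi> F" "{1..rank E}"] by (auto simp: rank_join_injection_def)

lemma rank_join_injection_mono:
  assumes "rank_join_injection \<phi>" "F \<in> cyclic_flats" "G \<in> cyclic_flats" "F \<subseteq> G"
  shows "\<phi> F \<subseteq> \<phi> G"
proof -
  have "cl (F \<union> G) = G" using assms cyclic_flatsD by (simp add: Un_absorb1)
  then show ?thesis using rank_join_injectionD(4)[OF assms(1-3)] by auto
qed

text \<open>By (2) the cyclic flats \<open>F\<close> with \<open>i \<notin> \<phi> F\<close> are
  closed under joins, so a maximal one contains all others; by monotonicity of \<open>\<phi>\<close>
  everything below it avoids \<open>i\<close> too.\<close>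

lemma ex_largest_cyclic_flat_avoiding:
  assumes \<phi>: "rank_join_injection \<phi>"
  obtains Z where "Z \<in> cyclic_flats" "\<And>F. F \<in> cyclic_flats \<Longrightarrow> i \<in> \<phi> F \<longleftrightarrow> \<not> F \<subseteq> Z"
proof -
  let ?S = "{F \<in> cyclic_flats. i \<notin> \<phi> F}"
  \<comment> \<open>The least cyclic flat has rank 0, so by (1) its image is empty and avoids every
    \<open>i\<close>.\<close>
  have cl0: "cl {} \<in> cyclic_flats" using cl_in_cyclic_flats[OF cyclic_empty] .
  have "rank {} = 0" using rank_indep[OF indep_empty] by simp
  then have "\<phi> (cl {}) = {}" using rank_join_injectionD[OF \<phi> cl0] rank_cl by simp
  then have "?S \<noteq> {}" using cl0 by blast
  moreover have "finite ?S" using finite_cyclic_flats by simp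
  ultimately obtain Z where Z: "Z \<in> ?S" and max: "\<And>Y. Y \<in> ?S \<Longrightarrow> Z \<subseteq> Y \<Longrightarrow> Z = Y"
    by (metis (no_types, lifting) finite_has_maximal)
  have "i \<in> \<phi> F \<longleftrightarrow> \<not> F \<subseteq> Z" if F: "F \<in> cyclic_flats" for F
  proof
    assume "i \<in> \<phi> F"
    then show "\<not> F \<subseteq> Z" using rank_join_injection_mono[OF \<phi> F] Z by blast
  next
    assume n: "\<not> F \<subseteq> Z"
    have ZF: "Z \<union> F \<subseteq> cl (Z \<union> F)" by (rule subset_cl) (use Z F cyclic_flatsD in auto)
    show "i \<in> \<phi> F"
    proof (rule ccontr)
      assume "i \<notin> \<phi> F"
      then have "cl (Z \<union> F) \<in> ?S"
        using Z F join_in_cyclic_flats rank_join_injectionD(4)[OF \<phi>, of Z F] by blast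
      then have "Z = cl (Z \<union> F)" by (rule max) (use ZF in blast)
      then show False using ZF n by blast
    qed
  qed
  then show ?thesis using that Z by blast
qed

lemma rank_join_injection_imp_fundamental_transversal:
  assumes \<phi>: "rank_join_injection \<phi>"
    and int: "\<And>\<F>. \<F> \<subseteq> cyclic_flats \<Longrightarrow> rank_inter_eq \<phi> \<F>"
  shows fundamental_transversal
proof -
  let ?R = "{1..rank E}"
  have "\<forall>i. \<exists>Z. Z \<in> cyclic_flats \<and> (\<forall>F\<in>cyclic_flats. i \<in> \<phi> F \<longleftrightarrow> \<not> F \<subseteq> Z)"
    using ex_largest_cyclic_flat_avoiding[OF \<phi>] by metis
  then obtain Z where Z: "\<And>i. Z i \<in> cyclic_flats"
    and in_\<phi>: "\<And>i F. F \<in> cyclic_flats \<Longrightarrow> i \<in> \<phi> F \<longleftrightarrow> \<not> F \<subseteq> Z i"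
    by metis
  \<comment> \<open>\<open>E\<close> takes over when no cyclic flat lies outside \<open>Y\<close>.
    \<open>K Y\<close> gathers the indices that share \<open>Y\<close> as their largest avoiding
    flat and so compete for elements of \<open>X Y - Y\<close>.\<close>
  define X where "X Y = E \<inter> \<Inter>{F \<in> cyclic_flats. \<not> F \<subseteq> Y}" for Y
  define K where "K Y = {j \<in> ?R. Z j = Y}" for Y
  have "\<exists>g. inj_on g (K Y) \<and> g ` K Y \<subseteq> X Y - Y" if Y: "Y \<in> cyclic_flats" for Y
  proof -
    let ?\<F> = "{F \<in> cyclic_flats. \<not> F \<subseteq> Y}"
    \<comment> \<open>\<open>?P\<close> is the counterpart of \<open>X Y\<close> under
      \<open>\<phi>\<close>. Condition (3) is applied to \<open>?\<F>\<close> and to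
      \<open>insert Y ?\<F>\<close>; subtracting the two equations compares
      \<open>?P - \<phi> Y\<close> with \<open>X Y - Y\<close>.\<close>
    let ?P = "?R \<inter> (\<Inter>F\<in>?\<F>. \<phi> F)"
    have r1: "rank (X Y) = card ?P"
      using int[of ?\<F>] by (auto simp: rank_inter_eq_def X_def)
    have "X Y \<inter> Y = E \<inter> (\<Inter>F\<in>insert Y ?\<F>. F)" by (auto simp: X_def)
    moreover have "?P \<inter> \<phi> Y = ?R \<inter> (\<Inter>F\<in>insert Y ?\<F>. \<phi> F)" by auto
    ultimately have r2: "rank (X Y \<inter> Y) = card (?P \<inter> \<phi> Y)"
      using int[of "insert Y ?\<F>"] Y by (auto simp: rank_inter_eq_def)
    have finX: "finite (X Y)" using finite_ground by (simp add: X_def)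
    have "K Y \<subseteq> ?P - \<phi> Y" using in_\<phi> Y by (auto simp: K_def)
    then have "card (K Y) \<le> card (?P - \<phi> Y)" by (intro card_mono) auto
    also have "\<dots> \<le> card (X Y - Y)"
      using card_Int_Diff[of ?P "\<phi> Y"] rank_le_rank_Int_plus_card_Diff[OF finX, of Y] r1 r2 by simp
    finally show ?thesis
      using card_le_inj[of "K Y" "X Y - Y"] finX by (auto simp: K_def)
  qed
  then obtain g where g: "\<And>Y. Y \<in> cyclic_flats \<Longrightarrow> inj_on (g Y) (K Y)"
    "\<And>Y. Y \<in> cyclic_flats \<Longrightarrow> g Y ` K Y \<subseteq> X Y - Y"
    by metis
  define e where "e i = g (Z i) i" for i
  have e: "e i \<in> X (Z i) - Z i" if "i \<in> ?R" for i
    using g(2)[OF Z[of i]] that by (auto simp: e_def K_def)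
  \<comment> \<open>If \<open>i \<in> \<phi> F\<close>, then \<open>F\<close> is among the flats
    intersected in \<open>X (Z i)\<close>, so it contains \<open>e i\<close>; otherwise
    \<open>F \<subseteq> Z i\<close>, which misses \<open>e i\<close>.\<close>
  have e_in: "e i \<in> F \<longleftrightarrow> i \<in> \<phi> F" if "i \<in> ?R" "F \<in> cyclic_flats" for i F
    using e[OF that(1)] in_\<phi>[OF that(2)] that(2) by (auto simp: X_def)
  have inj: "inj_on e ?R"
  proof (rule inj_onI)
    fix i j assume ij: "i \<in> ?R" "j \<in> ?R" "e i = e j"
    \<comment> \<open>If \<open>Z i\<close> were not inside \<open>Z j\<close>, it would be
      intersected in \<open>X (Z j)\<close> and contain \<open>e j\<close>, which equals
      \<open>e i\<close> and lies outside \<open>Z i\<close>. The roles of \<open>i\<close> and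
      \<open>j\<close> are symmetric.\<close>
    have "Z i = Z j"
      using e[OF ij(1)] e[OF ij(2)] ij(3) Z unfolding X_def by auto
    then show "i = j" using g(1)[OF Z[of i]] ij by (auto simp: e_def K_def inj_on_def)
  qed
  define B where "B = e ` ?R"
  have cardB: "card B = rank E" using card_image[OF inj] by (simp add: B_def)
  have span: "card (B \<inter> F) = rank F" if F: "F \<in> cyclic_flats" for F
  proof -
    have "B \<inter> F = e ` \<phi> F"
      using e_in[OF _ F] rank_join_injectionD(1)[OF \<phi> F] by (auto simp: B_def)
    then show ?thesis
      using card_image[OF inj_on_subset[OF inj]] rank_join_injectionD(1,2)[OF \<phi> F] by metis
  qed
  have BE: "B \<subseteq> E" using e by (auto simp: B_def X_def)
  \<comment> \<open>A circuit \<open>C\<close> inside \<open>B\<close> would lie in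
    \<open>B \<inter> cl C\<close>, which has \<open>rank C\<close> elements, fewer than
    \<open>C\<close>.\<close>
  have "indep B"
  proof (rule ccontr)
    assume "\<not> indep B"
    then obtain C where C: "circuit C" "C \<subseteq> B" using dependent_contains_circuit BE by blast
    have "C \<subseteq> B \<inter> cl C" using C BE subset_cl by blast
    then have "card C \<le> card (B \<inter> cl C)"
      using finite_subset[OF BE finite_ground] by (intro card_mono) auto
    also have "\<dots> = rank C" using span[OF cl_in_cyclic_flats[OF cyclic_circuit[OF C(1)]]] rank_cl by simp
    finally show False using circuit_rank_less[OF C(1)] by simp
  qed
  then show ?thesis
    using fundamental_basis_imp_fundamental_transversal cardB span by blast
qed

section \<open>From a fundamental presentation to the injection\<close>

text \<open>Private elements are independent and bound ranks from below; the number of sets met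
  bounds them from above. The bounds agree on any set that contains \<open>e i\<close> whenever it
  meets \<open>As ! i\<close>.\<close>

lemma fundamental_transversal_imp_rank_join_injection:
  assumes fundamental_transversal
  obtains \<phi> where "rank_join_injection \<phi>" "\<And>\<F>. \<F> \<subseteq> cyclic_flats \<Longrightarrow> rank_inter_eq \<phi> \<F>"
proof -
  obtain As where pres: "presentation As"
    and priv: "\<forall>i<length As. As ! i - (\<Union>j\<in>{..<length As} - {i}. As ! j) \<noteq> {}"
    using assms unfolding fundamental_transversal_def by blast
  define n where "n = length As"
  have AsE: "As ! i \<subseteq> E" if "i < n" for i
    using pres that by (auto simp: presentation_def set_system_def n_def)
  have indep_iff: "indep I \<longleftrightarrow> I \<subseteq> E \<and> (\<exists>\<psi>. inj_on \<psi> I \<and> (\<forall>x\<in>I. \<psi> x < n \<and> x \<in> As ! \<psi> x))" for I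
    using pres unfolding presentation_def partial_transversal_def n_def by blast
  have "\<forall>i. \<exists>x. i < n \<longrightarrow> x \<in> As ! i - (\<Union>j\<in>{..<n} - {i}. As ! j)"
    using priv unfolding n_def by blast
  then obtain e where e': "\<And>i. i < n \<Longrightarrow> e i \<in> As ! i - (\<Union>j\<in>{..<n} - {i}. As ! j)" by metis
  have e: "e i \<in> As ! j \<longleftrightarrow> j = i" if "i < n" "j < n" for i j using e'[OF that(1)] that by auto
  have eE: "e i \<in> E" if "i < n" for i using e' AsE that by blast
  have inj_e: "inj_on e {..<n}" using e by (metis inj_onI lessThan_iff)
  have indep_e: "indep (e ` J)" if J: "J \<subseteq> {..<n}" for J
  proof -
    have "inj_on (the_inv_into J e) (e ` J)"
      using inj_on_subset[OF inj_e J] by (rule inj_on_the_inv_into)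
    moreover have "\<forall>x\<in>e ` J. the_inv_into J e x < n \<and> x \<in> As ! the_inv_into J e x"
      using the_inv_into_f_f[OF inj_on_subset[OF inj_e J]] J e by (auto simp: subset_iff)
    ultimately show ?thesis unfolding indep_iff using J eE by blast
  qed
  have rank_e: "card J \<le> rank Y" if "J \<subseteq> {..<n}" "e ` J \<subseteq> Y" for J Y
    using card_le_rank[OF indep_e[OF that(1)] that(2)] card_image[OF inj_on_subset[OF inj_e that(1)]]
    by simp
  have rank_le: "rank Y \<le> card J" if J: "J \<subseteq> {..<n}" and meets: "\<And>i. i < n \<Longrightarrow> As ! i \<inter> Y \<noteq> {} \<Longrightarrow> i \<in> J"
    for Y J
  proof -
    obtain I where I: "I \<subseteq> Y" "indep I" "card I = rank Y" using ex_indep_card_rank by blast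
    then obtain \<psi> where \<psi>: "inj_on \<psi> I" "\<forall>x\<in>I. \<psi> x < n \<and> x \<in> As ! \<psi> x" using indep_iff by blast
    \<comment> \<open>A transversal of an independent subset of \<open>Y\<close> only uses sets that
      meet \<open>Y\<close>.\<close>
    have "\<psi> ` I \<subseteq> J" using \<psi>(2) I(1) meets by blast
    then show ?thesis using card_inj_on_le[OF \<psi>(1)] I(3) finite_subset[OF J] by simp
  qed
  have rankE: "rank E = n"
    using rank_e[of "{..<n}" E] rank_le[of "{..<n}" E] eE by (simp add: image_subset_iff)
  have circuit_spans: "e i \<in> cl C" if C: "circuit C" and i: "i < n" and x: "x \<in> C" "x \<in> As ! i" for C i x
  proof (cases "e i \<in> C")
    case True
    then show ?thesis using subset_cl C by (auto simp: circuit_def)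
  next
    case False
    have ind: "indep (C - {x})" using C x by (auto simp: circuit_def)
    \<comment> \<open>A matching of this set must send \<open>e i\<close> to \<open>i\<close>, the
      only set containing it. Giving \<open>i\<close> to \<open>x\<close> instead would match all of
      \<open>C\<close>.\<close>
    have "\<not> indep (insert (e i) (C - {x}))"
    proof
      assume "indep (insert (e i) (C - {x}))"
      then obtain \<psi> where \<psi>: "inj_on \<psi> (insert (e i) (C - {x}))"
        "\<forall>y\<in>insert (e i) (C - {x}). \<psi> y < n \<and> y \<in> As ! \<psi> y" using indep_iff by blast
      have "\<psi> (e i) = i" using \<psi>(2) e[OF i] by auto
      then have "i \<notin> \<psi> ` (C - {x})" using \<psi>(1) False by (auto simp: inj_on_def)
      then have "inj_on (\<psi>(x := i)) C" using \<psi>(1) by (auto simp: inj_on_def)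
      moreover have "\<forall>y\<in>C. (\<psi>(x := i)) y < n \<and> y \<in> As ! (\<psi>(x := i)) y"
        using \<psi>(2) i x by auto
      ultimately have "indep C" unfolding indep_iff using C circuit_def by blast
      then show False using C by (simp add: circuit_def)
    qed
    then have "e i \<in> cl (C - {x})" using cl_indep_iff[OF ind eE[OF i]] by blast
    then show ?thesis using cl_mono[of "C - {x}" C] by blast
  qed
  have meets: "e i \<in> F" if F: "F \<in> cyclic_flats" and i: "i < n" "As ! i \<inter> F \<noteq> {}" for F i
  proof -
    obtain x C where "x \<in> As ! i" "x \<in> C" "circuit C" "C \<subseteq> F"
      using i cyclic_flatsD(2)[OF F] unfolding cyclic_def by blast
    then show ?thesis using circuit_spans i cl_mono[of C F] cyclic_flatsD(1)[OF F] by blast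
  qed
  define J where "J Y = {i. i < n \<and> e i \<in> Y}" for Y
  have Jn: "J Y \<subseteq> {..<n}" for Y by (auto simp: J_def)
  have finJ: "finite (J Y)" for Y using finite_subset[OF Jn] by simp
  have rankJ: "card (J F) = rank F" if F: "F \<in> cyclic_flats" for F
  proof (rule antisym)
    show "card (J F) \<le> rank F" by (rule rank_e[OF Jn]) (auto simp: J_def)
    show "rank F \<le> card (J F)" by (rule rank_le[OF Jn]) (use meets[OF F] in \<open>auto simp: J_def\<close>)
  qed
  have J_join: "J (cl (F \<union> G)) = J F \<union> J G" if F: "F \<in> cyclic_flats" and G: "G \<in> cyclic_flats" for F G
  proof -
    have sub: "J F \<union> J G \<subseteq> J (cl (F \<union> G))"
      using subset_cl[of "F \<union> G"] cyclic_flatsD(3)[OF F] cyclic_flatsD(3)[OF G] by (auto simp: J_def)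
    have "rank (F \<union> G) \<le> card (J F \<union> J G)"
    proof (rule rank_le)
      fix i assume i: "i < n" "As ! i \<inter> (F \<union> G) \<noteq> {}"
      then have "As ! i \<inter> F \<noteq> {} \<or> As ! i \<inter> G \<noteq> {}" by blast
      then show "i \<in> J F \<union> J G" using meets[OF F i(1)] meets[OF G i(1)] i(1) by (auto simp: J_def)
    qed (use Jn in blast)
    then have "card (J (cl (F \<union> G))) \<le> card (J F \<union> J G)"
      using rankJ[OF join_in_cyclic_flats[OF F G]] rank_cl by simp
    then show ?thesis using card_seteq[OF finJ sub] by simp
  qed
  have J_inj: "F = G" if F: "F \<in> cyclic_flats" and G: "G \<in> cyclic_flats" and eq: "J F = J G" for F G
  proof -
    \<comment> \<open>A cyclic flat is recovered from its indices, because its private elements form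
      a basis of it.\<close>
    have "H = cl (e ` J H)" if H: "H \<in> cyclic_flats" for H
    proof -
      have "card (e ` J H) = rank H" using card_image[OF inj_on_subset[OF inj_e Jn]] rankJ[OF H] by simp
      then have "cl H = cl (e ` J H)" by (intro cl_eq_cl_indep indep_e Jn) (auto simp: J_def)
      then show ?thesis using cyclic_flatsD(1)[OF H] by simp
    qed
    then show ?thesis using F G eq by metis
  qed
  \<comment> \<open>\<open>Suc\<close> moves the list indices, which start at 0, into
    \<open>{1..rank E}\<close>.\<close>
  define \<phi> where "\<phi> F = Suc ` J F" for F
  have card_\<phi>: "card (Suc ` S) = card S" for S by (rule card_image) simp
  have "rank_join_injection \<phi>"
    unfolding rank_join_injection_def
  proof (intro conjI ballI)
    show "inj_on \<phi> cyclic_flats"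
      using J_inj by (auto simp: \<phi>_def inj_on_def inj_image_eq_iff)
    show "\<phi> F \<subseteq> {1..rank E}" for F by (auto simp: \<phi>_def rankE J_def)
    show "card (\<phi> F) = rank F" if "F \<in> cyclic_flats" for F
      using rankJ[OF that] card_\<phi> by (simp add: \<phi>_def)
    show "\<phi> (cl (F \<union> G)) = \<phi> F \<union> \<phi> G" if "F \<in> cyclic_flats" "G \<in> cyclic_flats" for F G
      using J_join[OF that] by (simp add: \<phi>_def image_Un)
  qed
  moreover have "rank_inter_eq \<phi> \<F>" if \<F>: "\<F> \<subseteq> cyclic_flats" for \<F>
  proof -
    let ?Y = "E \<inter> (\<Inter>F\<in>\<F>. F)"
    have "{1..rank E} \<inter> (\<Inter>F\<in>\<F>. \<phi> F) = Suc ` J ?Y"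
    proof (intro equalityI subsetI)
      fix k assume k: "k \<in> {1..rank E} \<inter> (\<Inter>F\<in>\<F>. \<phi> F)"
      then obtain i where "k = Suc i" "i < n" by (cases k) (auto simp: rankE)
      then show "k \<in> Suc ` J ?Y" using k eE by (auto simp: J_def \<phi>_def)
    next
      fix k assume "k \<in> Suc ` J ?Y"
      then show "k \<in> {1..rank E} \<inter> (\<Inter>F\<in>\<F>. \<phi> F)" by (auto simp: J_def \<phi>_def rankE)
    qed
    \<comment> \<open>\<open>?Y\<close> need not be cyclic, but the property that meeting
      \<open>As ! i\<close> forces containing \<open>e i\<close> passes from cyclic flats to
      intersections.\<close>
    moreover have "rank ?Y = card (J ?Y)"
    proof (rule antisym)
      show "card (J ?Y) \<le> rank ?Y" by (rule rank_e[OF Jn]) (auto simp: J_def)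
      show "rank ?Y \<le> card (J ?Y)"
      proof (rule rank_le[OF Jn])
        fix i assume i: "i < n" "As ! i \<inter> ?Y \<noteq> {}"
        have "e i \<in> F" if "F \<in> \<F>" for F using meets[of F i] i that \<F> by blast
        then show "i \<in> J ?Y" using i eE by (auto simp: J_def)
      qed
    qed
    ultimately show ?thesis using card_\<phi> by (simp add: rank_inter_eq_def)
  qed
  ultimately show ?thesis using that by blast
qed

section \<open>Reduction to filters and antichains\<close>

text \<open>Each family refines the other from below, so the intersections agree; monotonicity of
  \<open>\<phi>\<close> gives the same for the images.\<close>

lemma rank_inter_eq_cofinal:
  assumes \<phi>: "rank_join_injection \<phi>" and sub: "\<F> \<subseteq> cyclic_flats" "\<G> \<subseteq> cyclic_flats"
    and FG: "\<And>F. F \<in> \<F> \<Longrightarrow> \<exists>G\<in>\<G>. G \<subseteq> F" and GF: "\<And>G. G \<in> \<G> \<Longrightarrow> \<exists>F\<in>\<F>. F \<subseteq> G"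
  shows "rank_inter_eq \<phi> \<F> \<longleftrightarrow> rank_inter_eq \<phi> \<G>"
proof -
  have "(\<Inter>F\<in>\<F>. F) = (\<Inter>F\<in>\<G>. F)"
  proof (intro equalityI INT_greatest)
    show "(\<Inter>F\<in>\<F>. F) \<subseteq> G" if "G \<in> \<G>" for G using GF[OF that] by blast
    show "(\<Inter>F\<in>\<G>. F) \<subseteq> F" if "F \<in> \<F>" for F using FG[OF that] by blast
  qed
  moreover have "(\<Inter>F\<in>\<F>. \<phi> F) = (\<Inter>F\<in>\<G>. \<phi> F)"
  proof (intro equalityI INT_greatest)
    fix G assume G: "G \<in> \<G>"
    obtain F where F: "F \<in> \<F>" "F \<subseteq> G" using GF[OF G] by blast
    have "\<phi> F \<subseteq> \<phi> G" by (rule rank_join_injection_mono[OF \<phi>]) (use F G sub in auto)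
    then show "(\<Inter>F\<in>\<F>. \<phi> F) \<subseteq> \<phi> G" using F(1) by blast
  next
    fix F assume F: "F \<in> \<F>"
    obtain G where G: "G \<in> \<G>" "G \<subseteq> F" using FG[OF F] by blast
    have "\<phi> G \<subseteq> \<phi> F" by (rule rank_join_injection_mono[OF \<phi>]) (use F G sub in auto)
    then show "(\<Inter>F\<in>\<G>. \<phi> F) \<subseteq> \<phi> F" using G(1) by blast
  qed
  ultimately show ?thesis unfolding rank_inter_eq_def by simp
qed

lemma rank_inter_eq_all_iff_filter:
  assumes \<phi>: "rank_join_injection \<phi>"
  shows "(\<forall>\<F>. \<F> \<subseteq> cyclic_flats \<longrightarrow> rank_inter_eq \<phi> \<F>) \<longleftrightarrow> (\<forall>\<F>. filter_cf \<F> \<longrightarrow> rank_inter_eq \<phi> \<F>)"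
proof (intro iffI allI impI)
  fix \<F> assume H: "\<forall>\<F>. filter_cf \<F> \<longrightarrow> rank_inter_eq \<phi> \<F>" and \<F>: "\<F> \<subseteq> cyclic_flats"
  \<comment> \<open>The filter generated by \<open>\<F>\<close>.\<close>
  let ?G = "{G \<in> cyclic_flats. \<exists>F\<in>\<F>. F \<subseteq> G}"
  have "filter_cf ?G" unfolding filter_cf_def by blast
  moreover have "rank_inter_eq \<phi> \<F> \<longleftrightarrow> rank_inter_eq \<phi> ?G"
    by (rule rank_inter_eq_cofinal[OF \<phi> \<F>]) (use \<F> in auto)
  ultimately show "rank_inter_eq \<phi> \<F>" using H by blast
qed (simp add: filter_cf_def)

lemma rank_inter_eq_all_iff_antichain:
  assumes \<phi>: "rank_join_injection \<phi>"
  shows "(\<forall>\<F>. \<F> \<subseteq> cyclic_flats \<longrightarrow> rank_inter_eq \<phi> \<F>) \<longleftrightarrow> (\<forall>\<F>. antichain_cf \<F> \<longrightarrow> rank_inter_eq \<phi> \<F>)"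
proof (intro iffI allI impI)
  fix \<F> assume H: "\<forall>\<F>. antichain_cf \<F> \<longrightarrow> rank_inter_eq \<phi> \<F>" and \<F>: "\<F> \<subseteq> cyclic_flats"
  \<comment> \<open>The minimal members of \<open>\<F>\<close>; finiteness puts one below each
    member.\<close>
  let ?G = "{G \<in> \<F>. \<forall>F\<in>\<F>. F \<subseteq> G \<longrightarrow> F = G}"
  have fin: "finite \<F>" by (rule finite_subset[OF \<F> finite_cyclic_flats])
  have "antichain_cf ?G" unfolding antichain_cf_def using \<F> by blast
  moreover have "rank_inter_eq \<phi> \<F> \<longleftrightarrow> rank_inter_eq \<phi> ?G"
  proof (rule rank_inter_eq_cofinal[OF \<phi> \<F>])
    fix F assume "F \<in> \<F>"
    from finite_has_minimal2[OF fin this] show "\<exists>G\<in>?G. G \<subseteq> F" by blast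
  qed (use \<F> in auto)
  ultimately show "rank_inter_eq \<phi> \<F>" using H by blast
qed (simp add: antichain_cf_def)

end

theorem theorem4p5:
  fixes E :: "'a set" and indep :: "'a set \<Rightarrow> bool"
  assumes "matroid E indep"
  shows
    "(matroid.fundamental_transversal E indep \<longleftrightarrow>
       (\<exists>\<phi>. matroid.rank_join_injection E indep \<phi> \<and>
            (\<forall>\<F>. \<F> \<subseteq> matroid.cyclic_flats E indep \<longrightarrow> matroid.rank_inter_eq E indep \<phi> \<F>))) \<and>
     (matroid.fundamental_transversal E indep \<longleftrightarrow>
       (\<exists>\<phi>. matroid.rank_join_injection E indep \<phi> \<and>
            (\<forall>\<F>. matroid.filter_cf E indep \<F> \<longrightarrow> matroid.rank_inter_eq E indep \<phi> \<F>))) \<and>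
     (matroid.fundamental_transversal E indep \<longleftrightarrow>
       (\<exists>\<phi>. matroid.rank_join_injection E indep \<phi> \<and>
            (\<forall>\<F>. matroid.antichain_cf E indep \<F> \<longrightarrow> matroid.rank_inter_eq E indep \<phi> \<F>))) \<and>
     (\<forall>\<phi>. matroid.rank_join_injection E indep \<phi> \<longrightarrow>
       ((\<forall>\<F>. \<F> \<subseteq> matroid.cyclic_flats E indep \<longrightarrow> matroid.rank_inter_eq E indep \<phi> \<F>) \<longleftrightarrow>
        (\<forall>\<F>. matroid.filter_cf E indep \<F> \<longrightarrow> matroid.rank_inter_eq E indep \<phi> \<F>)) \<and>
       ((\<forall>\<F>. \<F> \<subseteq> matroid.cyclic_flats E indep \<longrightarrow> matroid.rank_inter_eq E indep \<phi> \<F>) \<longleftrightarrow>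
        (\<forall>\<F>. matroid.antichain_cf E indep \<F> \<longrightarrow> matroid.rank_inter_eq E indep \<phi> \<F>)))"
proof -
  interpret matroid E indep by (rule assms)
  have char: "fundamental_transversal \<longleftrightarrow>
      (\<exists>\<phi>. rank_join_injection \<phi> \<and> (\<forall>\<F>. \<F> \<subseteq> cyclic_flats \<longrightarrow> rank_inter_eq \<phi> \<F>))"
    using rank_join_injection_imp_fundamental_transversal
    by (auto elim: fundamental_transversal_imp_rank_join_injection)
  show ?thesis
    \<comment> \<open>The three forms of (3) are equivalent only given (1) and (2);
      \<open>conj_cong\<close> supplies \<open>rank_join_injection \<phi>\<close> while the second
      conjunct is rewritten.\<close>
    using char by (simp add: rank_inter_eq_all_iff_filter[symmetric]
      rank_inter_eq_all_iff_antichain[symmetric] cong: conj_cong)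
qed

end
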